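(* For every integer $\ell\ge 2$, no witness of $D_{3\ell}(H_\ell)$ has size less than $|H_\ell|=6\ell-2$.
   Context: $\Lambda_i$ denotes the poset with $i$ minimal elements and one further element above all of them. $H_\ell$ is the poset whose connected components are $\ell$ copies of $\Lambda_2$ and one copy of $\Lambda_{3(\ell-1)}$. A downset is a downward-closed subset; $D_n(Q)$ is the set of downsets of $Q$ of size $n$ up to isomorphism. $Q$ is a witness of a set $\Gamma_n$ of unlabelled posets of size $n$ if $D_n(Q)=\Gamma_n$. *)

theory Defs
  imports Main
begin

definition finite_poset :: "'a set \<Rightarrow> ('a \<Rightarrow> 'a \<Rightarrow> bool) \<Rightarrow> bool" where
  "finite_poset A le \<longleftrightarrow> finite A \<and> (\<forall>x\<in>A. le x x)
     \<and> (\<forall>x\<in>A. \<forall>y\<in>A. le x y \<and> le y x \<longrightarrow> x = y)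
     \<and> (\<forall>x\<in>A. \<forall>y\<in>A. \<forall>z\<in>A. le x y \<and> le y z \<longrightarrow> le x z)"

definition is_downset :: "'a set \<Rightarrow> ('a \<Rightarrow> 'a \<Rightarrow> bool) \<Rightarrow> 'a set \<Rightarrow> bool" where
  "is_downset A le S \<longleftrightarrow> S \<subseteq> A \<and> (\<forall>x\<in>S. \<forall>y\<in>A. le y x \<longrightarrow> y \<in> S)"

definition poset_iso :: "'a set \<Rightarrow> ('a \<Rightarrow> 'a \<Rightarrow> bool) \<Rightarrow> 'b set \<Rightarrow> ('b \<Rightarrow> 'b \<Rightarrow> bool) \<Rightarrow> bool" where
  "poset_iso A le B le' \<longleftrightarrow>
     (\<exists>f. bij_betw f A B \<and> (\<forall>x\<in>A. \<forall>y\<in>A. le x y \<longleftrightarrow> le' (f x) (f y)))"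

definition downsets_sub :: "nat \<Rightarrow> 'a set \<Rightarrow> ('a \<Rightarrow> 'a \<Rightarrow> bool) \<Rightarrow> 'b set \<Rightarrow> ('b \<Rightarrow> 'b \<Rightarrow> bool) \<Rightarrow> bool" where
  "downsets_sub n A le B le' \<longleftrightarrow>
     (\<forall>S. is_downset A le S \<and> card S = n \<longrightarrow>
        (\<exists>T. is_downset B le' T \<and> card T = n \<and> poset_iso S le T le'))"

text \<open>D_n(A) = D_n(B) as sets of unlabelled posets.\<close>
definition same_downsets :: "nat \<Rightarrow> 'a set \<Rightarrow> ('a \<Rightarrow> 'a \<Rightarrow> bool) \<Rightarrow> 'b set \<Rightarrow> ('b \<Rightarrow> 'b \<Rightarrow> bool) \<Rightarrow> bool" where
  "same_downsets n A le B le' \<longleftrightarrow> downsets_sub n A le B le' \<and> downsets_sub n B le' A le"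

text \<open>The poset H_l on nat \<times> nat: components i < l are copies of Lambda_2
(minimal elements (i,0),(i,1), top (i,2)); component l is Lambda_{3(l-1)}
(minimal elements (l,j), j < 3(l-1), top (l,3(l-1))).\<close>
definition H_top :: "nat \<Rightarrow> nat \<Rightarrow> nat" where
  "H_top l i = (if i < l then 2 else 3 * (l - 1))"

definition H_carrier :: "nat \<Rightarrow> (nat \<times> nat) set" where
  "H_carrier l = {(i, j). i < l \<and> j \<le> 2} \<union> {(i, j). i = l \<and> j \<le> 3 * (l - 1)}"

definition H_le :: "nat \<Rightarrow> nat \<times> nat \<Rightarrow> nat \<times> nat \<Rightarrow> bool" where
  "H_le l x y \<longleftrightarrow> x = y \<or> (fst x = fst y \<and> snd y = H_top l (fst y))"

end

theory Submission
  imports Defs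
begin

text \<open>
Isomorphisms between downsets preserve the size \<open>|\<down>x|\<close> of principal downsets, so this size
recognises the elements of a witness \<open>Q\<close>. Copy into \<open>Q\<close> two downsets of \<open>H\<^sub>\<ell>\<close> of size \<open>3\<ell>\<close>:
\<open>S\<^sub>1\<close>, the union of all copies of \<open>\<Lambda>\<^sub>2\<close>, and \<open>S\<^sub>2\<close>, the big component together with two
minimal elements \<open>p, q\<close> of one copy of \<open>\<Lambda>\<^sub>2\<close>. An element \<open>x \<noteq> p, q\<close> of \<open>S\<^sub>1 \<inter> S\<^sub>2\<close> would lie
below the top \<open>t\<close> of \<open>S\<^sub>2\<close>, with \<open>|\<down>t| = 3\<ell> - 2\<close>, and below a top \<open>u\<close> of \<open>S\<^sub>1\<close>, with
\<open>|\<down>u| = 3\<close>. Then \<open>\<down>t \<union> \<down>u\<close>, padded with \<open>p\<close> if necessary, is a downset of size \<open>3\<ell>\<close>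
containing both tops, and no downset of \<open>H\<^sub>\<ell>\<close> of that size does. So \<open>|S\<^sub>1 \<inter> S\<^sub>2| \<le> 2\<close>,
whence \<open>|Q| \<ge> |S\<^sub>1 \<union> S\<^sub>2| \<ge> 6\<ell> - 2\<close>.
\<close>

definition principal_downset :: "'a set \<Rightarrow> ('a \<Rightarrow> 'a \<Rightarrow> bool) \<Rightarrow> 'a \<Rightarrow> 'a set" where
  "principal_downset A le x = {y \<in> A. le y x}"

lemma is_downset_Un:
  "is_downset A le S \<Longrightarrow> is_downset A le T \<Longrightarrow> is_downset A le (S \<union> T)"
  unfolding is_downset_def by blast

lemma is_downset_principal_downset:
  assumes "finite_poset A le" "x \<in> A"
  shows "is_downset A le (principal_downset A le x)"
  using assms unfolding is_downset_def finite_poset_def principal_downset_def by blast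

lemma self_in_principal_downset:
  "finite_poset A le \<Longrightarrow> x \<in> A \<Longrightarrow> x \<in> principal_downset A le x"
  unfolding finite_poset_def principal_downset_def by blast

lemma finite_principal_downset:
  "finite_poset A le \<Longrightarrow> finite (principal_downset A le x)"
  unfolding finite_poset_def principal_downset_def by simp

lemma principal_downset_in_downset:
  assumes "is_downset A le S" "x \<in> S"
  shows "principal_downset S le x = principal_downset A le x"
  using assms unfolding is_downset_def principal_downset_def by auto

lemma card_principal_downset_iso:
  assumes "bij_betw f S T" "\<forall>x\<in>S. \<forall>y\<in>S. le x y \<longleftrightarrow> le' (f x) (f y)" "x \<in> S"
  shows "card (principal_downset T le' (f x)) = card (principal_downset S le x)"
proof -
  have "principal_downset T le' (f x) = f ` principal_downset S le x"
    using assms bij_betw_imp_surj_on[OF assms(1)] bij_betwE[OF assms(1)]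
    unfolding principal_downset_def by auto
  moreover have "inj_on f (principal_downset S le x)"
    using bij_betw_imp_inj_on[OF assms(1)] unfolding principal_downset_def
    by (rule inj_on_subset) auto
  ultimately show ?thesis by (simp add: card_image)
qed

lemma downsets_subE:
  assumes "downsets_sub n A le B le'" "is_downset A le S" "card S = n"
  obtains T f where "is_downset B le' T" "card T = n" "bij_betw f S T"
    "\<forall>x\<in>S. \<forall>y\<in>S. le x y \<longleftrightarrow> le' (f x) (f y)"
    "\<forall>x\<in>S. card (principal_downset B le' (f x)) = card (principal_downset A le x)"
proof -
  obtain T f where T: "is_downset B le' T" "card T = n" and f: "bij_betw f S T"
    and mono: "\<forall>x\<in>S. \<forall>y\<in>S. le x y \<longleftrightarrow> le' (f x) (f y)"
    using assms unfolding downsets_sub_def poset_iso_def by blast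
  have "card (principal_downset B le' (f x)) = card (principal_downset A le x)" if "x \<in> S" for x
    using card_principal_downset_iso[OF f mono that] bij_betwE[OF f] that
      principal_downset_in_downset[OF T(1)] principal_downset_in_downset[OF assms(2)]
    by simp
  with T f mono that show thesis by blast
qed

text \<open>
The two principal downsets share one or two elements; in the second case \<open>p\<close> lies outside
both, since \<open>\<down>u\<close> has no room for it, and fills the union up to size \<open>m + 2\<close>.
\<close>
lemma downset_containing_principal_pair:
  assumes Q: "finite_poset Q le" and in_Q: "t \<in> Q" "u \<in> Q" "p \<in> Q"
    and cards: "card (principal_downset Q le t) = m" "card (principal_downset Q le u) = 3"
      "card (principal_downset Q le p) = 1"
    and incomparable: "\<not> le u t" "\<not> le p t"
    and meet: "x \<in> Q" "le x t" "le x u"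
  obtains D where "is_downset Q le D" "card D = m + 2" "t \<in> D" "u \<in> D"
proof -
  define Dt where "Dt = principal_downset Q le t"
  define Du where "Du = principal_downset Q le u"
  define I where "I = Dt \<inter> Du"
  have fin: "finite Dt" "finite Du"
    unfolding Dt_def Du_def using finite_principal_downset[OF Q] by auto
  have card_D: "card Dt = m" "card Du = 3"
    unfolding Dt_def Du_def using cards by auto
  have down: "is_downset Q le Dt" "is_downset Q le Du"
    unfolding Dt_def Du_def using is_downset_principal_downset[OF Q] in_Q by auto
  have tu: "t \<in> Dt" "u \<in> Du"
    unfolding Dt_def Du_def using self_in_principal_downset[OF Q] in_Q by auto
  have u_notin: "u \<notin> Dt" and p_notin: "p \<notin> Dt"
    using incomparable unfolding Dt_def principal_downset_def by auto
  have "finite I" using fin unfolding I_def by simp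
  have "x \<in> I" using meet unfolding I_def Dt_def Du_def principal_downset_def by auto
  then have "card I \<noteq> 0" using \<open>finite I\<close> by auto
  moreover have "card I \<le> 2"
  proof -
    have "card I \<le> card (Du - {u})"
      using fin u_notin unfolding I_def by (intro card_mono) auto
    then show ?thesis using tu card_D by simp
  qed
  moreover have card_Un: "card (Dt \<union> Du) + card I = m + 3"
    using card_Un_Int[OF fin] card_D unfolding I_def by simp
  ultimately consider "card I = 1" | "card I = 2" by linarith
  then show thesis
  proof cases
    case 1
    then show thesis using that[of "Dt \<union> Du"] is_downset_Un[OF down] card_Un tu by simp
  next
    case 2
    have Dp: "principal_downset Q le p = {p}"
      using cards(3) self_in_principal_downset[OF Q in_Q(3)] by (metis card_1_singletonE singletonD)
    have "p \<notin> Du"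
    proof
      assume "p \<in> Du"
      then have "insert u (insert p I) \<subseteq> Du" using tu unfolding I_def by auto
      then have "card (insert u (insert p I)) \<le> 3" using card_mono[OF fin(2)] card_D by metis
      moreover have "u \<noteq> p" using cards(2,3) by auto
      then have "card (insert u (insert p I)) = 4"
        using 2 p_notin u_notin \<open>finite I\<close> unfolding I_def by simp
      ultimately show False by simp
    qed
    then have "card (Dt \<union> Du \<union> {p}) = m + 2" using card_Un 2 p_notin fin by simp
    moreover have "is_downset Q le (Dt \<union> Du \<union> {p})"
      using is_downset_Un[OF is_downset_Un[OF down] is_downset_principal_downset[OF Q in_Q(3)]] Dp
      by simp
    ultimately show thesis using that[of "Dt \<union> Du \<union> {p}"] tu by simp
  qed
qed

lemma H_carrier_eq: "H_carrier l = {..<l} \<times> {..2} \<union> {l} \<times> {..3 * (l - 1)}"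
  unfolding H_carrier_def by auto

lemma card_H_carrier: "l \<ge> 1 \<Longrightarrow> card (H_carrier l) = 6 * l - 2"
  unfolding H_carrier_eq by (subst card_Un_disjoint) (auto simp: card_cartesian_product)

lemma card_principal_downset_H:
  assumes "(i, j) \<in> H_carrier l"
  shows "card (principal_downset (H_carrier l) (H_le l) (i, j)) =
    (if j = H_top l i then H_top l i + 1 else 1)"
proof (cases "j = H_top l i")
  case True
  then have "principal_downset (H_carrier l) (H_le l) (i, j) = {i} \<times> {..H_top l i}"
    using assms unfolding principal_downset_def H_carrier_def H_le_def H_top_def
    by (auto split: if_splits)
  then show ?thesis using True by (simp add: card_cartesian_product)
next
  case False
  then have "principal_downset (H_carrier l) (H_le l) (i, j) = {(i, j)}"
    using assms unfolding principal_downset_def H_le_def by auto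
  then show ?thesis using False by simp
qed

text \<open>A downset of \<open>H\<^sub>\<ell>\<close> containing the big top and the top of a copy of \<open>\<Lambda>\<^sub>2\<close> has
\<open>(3\<ell> - 2) + 3\<close> elements.\<close>
lemma H_downset_no_two_tops:
  assumes "l \<ge> 2" "is_downset (H_carrier l) (H_le l) T" "card T = 3 * l" "y \<in> T" "z \<in> T"
    "card (principal_downset (H_carrier l) (H_le l) y) = 3 * l - 2"
  shows "card (principal_downset (H_carrier l) (H_le l) z) \<noteq> 3"
proof
  assume z: "card (principal_downset (H_carrier l) (H_le l) z) = 3"
  have TH: "T \<subseteq> H_carrier l" using assms(2) unfolding is_downset_def by blast
  obtain i j where z_eq: "z = (i, j)" by fastforce
  then have "i < l" and y_eq: "y = (l, 3 * (l - 1))"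
    using card_principal_downset_H[of _ _ l] assms(1,4,5,6) z TH
    unfolding H_carrier_eq H_top_def by (auto split: if_splits)
  have "principal_downset (H_carrier l) (H_le l) y \<union> principal_downset (H_carrier l) (H_le l) z
      \<subseteq> T"
    using assms(2,4,5) unfolding is_downset_def principal_downset_def by blast
  moreover have "principal_downset (H_carrier l) (H_le l) y \<inter>
      principal_downset (H_carrier l) (H_le l) z = {}"
    using \<open>i < l\<close> z_eq y_eq unfolding principal_downset_def H_le_def by auto
  moreover have "finite T" using assms(1,3) card.infinite by fastforce
  ultimately have "card (principal_downset (H_carrier l) (H_le l) y) +
      card (principal_downset (H_carrier l) (H_le l) z) \<le> card T"
    by (metis card_Un_disjoint card_mono finite_Un finite_subset)
  then show False using assms(1,3,6) z by linarith
qed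

lemma witness_downset_no_two_tops:
  assumes "l \<ge> 2" "downsets_sub (3 * l) Q le (H_carrier l) (H_le l)"
    "is_downset Q le D" "card D = 3 * l" "t \<in> D" "u \<in> D"
    "card (principal_downset Q le t) = 3 * l - 2"
  shows "card (principal_downset Q le u) \<noteq> 3"
proof -
  obtain T h where T: "is_downset (H_carrier l) (H_le l) T" "card T = 3 * l"
    and h: "bij_betw h D T" and "\<forall>x\<in>D. \<forall>y\<in>D. le x y \<longleftrightarrow> H_le l (h x) (h y)"
    and cards: "\<forall>x\<in>D. card (principal_downset (H_carrier l) (H_le l) (h x)) =
      card (principal_downset Q le x)"
    by (rule downsets_subE[OF assms(2-4)])
  have "h t \<in> T" "h u \<in> T" using h assms(5,6) bij_betwE by blast+
  moreover have "card (principal_downset (H_carrier l) (H_le l) (h t)) = 3 * l - 2"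
    using cards assms(5,7) by simp
  ultimately have "card (principal_downset (H_carrier l) (H_le l) (h u)) \<noteq> 3"
    by (rule H_downset_no_two_tops[OF assms(1) T])
  then show ?thesis using cards assms(6) by simp
qed

lemma witness_image_of_Lambda2s:
  assumes "downsets_sub (3 * l) (H_carrier l) (H_le l) Q le"
  obtains S where "is_downset Q le S" "card S = 3 * l"
    "\<forall>x\<in>S. \<exists>u\<in>S. le x u \<and> card (principal_downset Q le u) = 3"
proof -
  let ?T = "{..<l} \<times> {..2::nat}"
  have "is_downset (H_carrier l) (H_le l) ?T"
    unfolding is_downset_def H_carrier_def H_le_def by auto
  moreover have "card ?T = 3 * l" by (simp add: card_cartesian_product)
  ultimately obtain S f where S: "is_downset Q le S" "card S = 3 * l" and f: "bij_betw f ?T S"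
    and mono: "\<forall>x\<in>?T. \<forall>y\<in>?T. H_le l x y \<longleftrightarrow> le (f x) (f y)"
    and cards: "\<forall>x\<in>?T. card (principal_downset Q le (f x)) =
      card (principal_downset (H_carrier l) (H_le l) x)"
    by (rule downsets_subE[OF assms])
  have "\<exists>u\<in>S. le x u \<and> card (principal_downset Q le u) = 3" if x: "x \<in> S" for x
  proof -
    obtain i j where ij: "(i, j) \<in> ?T" "x = f (i, j)"
      using f x by (auto simp: bij_betw_def)
    then have top: "(i, 2) \<in> ?T" by auto
    have "H_le l (i, j) (i, 2)" using ij unfolding H_le_def H_top_def by auto
    then have "le x (f (i, 2))" using mono ij top by blast
    moreover have "card (principal_downset Q le (f (i, 2))) = 3"
      using cards top card_principal_downset_H[of i 2 l] unfolding H_carrier_def H_top_def by auto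
    moreover have "f (i, 2) \<in> S" using f top bij_betwE by blast
    ultimately show ?thesis by blast
  qed
  with S that show thesis by blast
qed

lemma witness_image_of_big_component:
  assumes "l \<ge> 2" "downsets_sub (3 * l) (H_carrier l) (H_le l) Q le"
  obtains S t p q where "is_downset Q le S" "card S = 3 * l" "t \<in> S" "p \<in> S"
    "card (principal_downset Q le t) = 3 * l - 2" "card (principal_downset Q le p) = 1"
    "\<not> le p t" "\<forall>x\<in>S - {p, q}. le x t" "\<forall>x\<in>S. card (principal_downset Q le x) \<noteq> 3"
proof -
  define top where "top = (l, 3 * (l - 1))"
  let ?T = "{l} \<times> {..3 * (l - 1)} \<union> {(0, 0), (0, 1)}"
  have "is_downset (H_carrier l) (H_le l) ?T"
    using assms(1) unfolding is_downset_def H_carrier_def H_le_def H_top_def by auto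
  moreover have "card ?T = 3 * l"
    using assms(1) by (subst card_Un_disjoint) (auto simp: card_cartesian_product)
  ultimately obtain S g where S: "is_downset Q le S" "card S = 3 * l" and g: "bij_betw g ?T S"
    and mono: "\<forall>x\<in>?T. \<forall>y\<in>?T. H_le l x y \<longleftrightarrow> le (g x) (g y)"
    and cards: "\<forall>x\<in>?T. card (principal_downset Q le (g x)) =
      card (principal_downset (H_carrier l) (H_le l) x)"
    by (rule downsets_subE[OF assms(2)])
  have top_in: "top \<in> ?T" "(0, 0) \<in> ?T" unfolding top_def by auto
  have cards_T: "card (principal_downset Q le (g z)) = (if z = top then 3 * l - 2 else 1)"
    if z: "z \<in> ?T" for z
  proof -
    obtain i j where ij: "z = (i, j)" by fastforce
    then have "(i, j) \<in> H_carrier l" using z assms(1) unfolding H_carrier_def by auto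
    from card_principal_downset_H[OF this] show ?thesis
      using cards z ij assms(1) unfolding top_def H_top_def by auto
  qed
  have below_top: "le (g z) (g top)" if z: "z \<in> ?T" "z \<notin> {(0, 0), (0, 1)}" for z
  proof -
    have "H_le l z top" using z unfolding top_def H_le_def H_top_def by auto
    then show ?thesis using mono z top_in by blast
  qed
  show thesis
  proof (rule that[OF S])
    show "g top \<in> S" "g (0, 0) \<in> S" using g top_in bij_betwE by blast+
    show "card (principal_downset Q le (g top)) = 3 * l - 2" using cards_T[OF top_in(1)] by simp
    show "card (principal_downset Q le (g (0, 0))) = 1"
      using cards_T[OF top_in(2)] assms(1) unfolding top_def by simp
    have "\<not> H_le l (0, 0) top" using assms(1) unfolding top_def H_le_def H_top_def by auto
    then show "\<not> le (g (0, 0)) (g top)" using mono top_in by blast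
    show "\<forall>x\<in>S - {g (0, 0), g (0, 1)}. le x (g top)"
      using g below_top unfolding bij_betw_def by auto
    show "\<forall>x\<in>S. card (principal_downset Q le x) \<noteq> 3"
    proof
      fix x assume "x \<in> S"
      then obtain z where "z \<in> ?T" "x = g z" using g unfolding bij_betw_def by auto
      moreover have "3 * l - 2 \<noteq> 3" by arith
      ultimately show "card (principal_downset Q le x) \<noteq> 3" using cards_T[of z] by auto
    qed
  qed
qed

lemma witness_images_Int_subset:
  assumes "l \<ge> 2" and Q: "finite_poset Q le"
    and witness: "downsets_sub (3 * l) Q le (H_carrier l) (H_le l)"
    and S1: "is_downset Q le S1" "\<forall>x\<in>S1. \<exists>u\<in>S1. le x u \<and> card (principal_downset Q le u) = 3"
    and S2: "is_downset Q le S2" "t \<in> S2" "p \<in> S2"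
      "card (principal_downset Q le t) = 3 * l - 2" "card (principal_downset Q le p) = 1"
      "\<not> le p t" "\<forall>x\<in>S2 - {p, q}. le x t" "\<forall>x\<in>S2. card (principal_downset Q le x) \<noteq> 3"
  shows "S1 \<inter> S2 \<subseteq> {p, q}"
proof
  fix x assume x: "x \<in> S1 \<inter> S2"
  show "x \<in> {p, q}"
  proof (rule ccontr)
    assume "x \<notin> {p, q}"
    then have "le x t" using S2(7) x by blast
    obtain u where u: "u \<in> S1" "le x u" "card (principal_downset Q le u) = 3"
      using S1(2) x by blast
    have in_Q: "x \<in> Q" "t \<in> Q" "u \<in> Q" "p \<in> Q"
      using S1(1) S2(1-3) x u(1) unfolding is_downset_def by auto
    have "\<not> le u t"
    proof
      assume "le u t"
      then have "u \<in> S2" using S2(1,2) in_Q(3) unfolding is_downset_def by blast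
      then show False using S2(8) u(3) by blast
    qed
    moreover have "3 * l - 2 + 2 = 3 * l" using assms(1) by simp
    ultimately obtain D where "is_downset Q le D" "card D = 3 * l" "t \<in> D" "u \<in> D"
      using downset_containing_principal_pair[OF Q in_Q(2-4) S2(4) u(3) S2(5)]
        S2(6) in_Q(1) \<open>le x t\<close> u(2) by metis
    then show False
      using witness_downset_no_two_tops[OF assms(1) witness] S2(4) u(3) by blast
  qed
qed

theorem mainTheorem8:
  fixes l :: nat and Q :: "'a set" and le :: "'a \<Rightarrow> 'a \<Rightarrow> bool"
  assumes "l \<ge> 2"
    and "finite_poset Q le"
    and "same_downsets (3 * l) Q le (H_carrier l) (H_le l)"
  shows "card (H_carrier l) = 6 * l - 2 \<and> card Q \<ge> card (H_carrier l)"
proof -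
  have "finite Q" using assms(2) unfolding finite_poset_def by simp
  have HQ: "downsets_sub (3 * l) (H_carrier l) (H_le l) Q le"
    and QH: "downsets_sub (3 * l) Q le (H_carrier l) (H_le l)"
    using assms(3) unfolding same_downsets_def by auto
  obtain S1 where S1: "is_downset Q le S1" "card S1 = 3 * l"
    "\<forall>x\<in>S1. \<exists>u\<in>S1. le x u \<and> card (principal_downset Q le u) = 3"
    using witness_image_of_Lambda2s[OF HQ] by blast
  obtain S2 t p q where S2: "is_downset Q le S2" "card S2 = 3 * l" "t \<in> S2" "p \<in> S2"
    "card (principal_downset Q le t) = 3 * l - 2" "card (principal_downset Q le p) = 1"
    "\<not> le p t" "\<forall>x\<in>S2 - {p, q}. le x t" "\<forall>x\<in>S2. card (principal_downset Q le x) \<noteq> 3"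
    using witness_image_of_big_component[OF assms(1) HQ] by blast
  have fin: "finite S1" "finite S2"
    using \<open>finite Q\<close> S1(1) S2(1) finite_subset unfolding is_downset_def by auto
  have "card (S1 \<inter> S2) \<le> card {p, q}"
    using witness_images_Int_subset[OF assms(1,2) QH S1(1,3) S2(1) S2(3-9)]
    by (intro card_mono) auto
  also have "\<dots> \<le> 2" by (simp add: card_insert_if)
  finally have "6 * l \<le> card (S1 \<union> S2) + 2"
    using card_Un_Int[OF fin] S1(2) S2(2) by simp
  moreover have "card (S1 \<union> S2) \<le> card Q"
    using \<open>finite Q\<close> S1(1) S2(1) unfolding is_downset_def by (intro card_mono) auto
  ultimately show ?thesis using card_H_carrier[of l] assms(1) by simp
qed

end
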